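(* Let $q$ be a prime power, let $n\ge 1$, $r\ge 0$, $t\ge 0$ be integers with $n-r-1\ge 1$, and let $u\le \min\{n,\lfloor\frac{q-1}{2}\rfloor\}$. Let $\mathcal{C}$ be an $[n,k,d]_q$ linear code with $k=n-r$ and $d\ge 2t+1$, having a generator matrix of the form $$\boldsymbol{G}=\begin{bmatrix}\boldsymbol{G}_1\\ \boldsymbol{G}_0\end{bmatrix}=\begin{bmatrix}\boldsymbol{0}_{(n-r-1)\times 1} & \boldsymbol{I}_{n-r-1} & \boldsymbol{P}\\ 1 & \boldsymbol{1}_{n-r-1} & \boldsymbol{1}_{r}\end{bmatrix},\qquad \boldsymbol{P}\in\mathbb{F}_q^{(n-r-1)\times r},$$ where $\boldsymbol{1}_\ell$ is the all-one row vector of length $\ell$ (so $\boldsymbol{G}_0$ is the all-one vector of length $n$). Consider the following coding scheme. Encoder: given a set $\phi\subseteq\{0,\dots,n-1\}$ with $|\phi|=u$ and a message $\boldsymbol{m}\in\mathbb{F}_q^{n-r-1}$, put $\boldsymbol{w}=\boldsymbol{m}\boldsymbol{G}_1$, find $v\in\mathbb{F}_q$ such that $w_i\ne v$ and $w_i\neq v+1$ for all $i\in\phi$, and output $\boldsymbol{c}=\boldsymbol{w}+z_0\boldsymbol{G}_0$ with $z_0=-(v+1)$. Decoder: given $\boldsymbol{y}=\boldsymbol{c}+\boldsymbol{e}$, decode $\boldsymbol{y}$ in $\mathcal{C}$ to the nearest codeword $\hat{\boldsymbol{c}}$, and output the unique $\hat{\boldsymbol{m}}\in\mathbb{F}_q^{n-r-1}$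 with $\hat{\boldsymbol{c}}=\hat{\boldsymbol{m}}\boldsymbol{G}_1+\hat z_0\boldsymbol{G}_0$ for some $\hat z_0\in\mathbb{F}_q$. Then the encoder always succeeds (such a $v$ always exists), its output satisfies $c_i\in\mathbb{F}_q\setminus\{0,-1\}$ for all $i\in\phi$, and the scheme is an $(n,q^{n-r-1})_q$ $(u,t)$-PDMC.
   Context: Vectors are row vectors indexed by $\{0,\dots,n-1\}$. All arithmetic is in the finite field $\mathbb{F}_q$; the element written $q-1$ in the level notation is $-1\in\mathbb{F}_q$. An $[n,k,d]_q$ code is a $k$-dimensional linear subspace of $\mathbb{F}_q^n$ with minimum Hamming distance $d$. A cell is partially defective at level $1$ if it can store every value of $\mathbb{F}_q$ except $0$. Admissible error vectors are $\boldsymbol{e}\in\{0,1\}^n\subseteq\mathbb{F}_q^n$ of Hamming weight at most $t$; errors may occur at any position, including the partially defective positions. An $(n,M)_q$ $(u,t)$-PDMC (code for partially defective memory cells) is a pair (encoder $\mathcal{E}$, decoder $\mathcal{D}$) with a message set $\mathcal{M}$ of size $M$ such that: $\mathcal{E}$ takes a set $\phi\subseteq\{0,\dots,n-1\}$ of $u$ positions (cells partially defective at level $1$) and a message $\boldsymbol{m}\in\mathcal{M}$, and outputs $\boldsymbol{c}\in\mathbb{F}_q^n$ such that for every admissible error vector $\boldsymbol{e}$ one has $c_i+e_i\neq 0$ for all $i\in\phi$; and $\mathcal{D}$, which is given only $\boldsymbol{c}+\boldsymbol{e}$ (not $\phi$), returns $\boldsymbol{m}$ for every admissible $\boldsymbol{e}$.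 *)

theory Defs
  imports "Jordan_Normal_Form.VS_Connect" "HOL-Library.Cardinality"
begin

definition hamming_dist :: "'a vec \<Rightarrow> 'a vec \<Rightarrow> nat" where
  "hamming_dist x y = card {i. i < dim_vec x \<and> x $ i \<noteq> y $ i}"

definition hamming_weight :: "'a::zero vec \<Rightarrow> nat" where
  "hamming_weight x = card {i. i < dim_vec x \<and> x $ i \<noteq> 0}"

text \<open>The minimum below is over a finite set, since distances of vectors of length \<open>n\<close> are at
  most \<open>n\<close>; the set is nonempty as soon as the code has two elements, and otherwise the value is
  unspecified.\<close>

definition min_distance :: "'a vec set \<Rightarrow> nat" where
  "min_distance C = Min {hamming_dist x y | x y. x \<in> C \<and> y \<in> C \<and> x \<noteq> y}"

abbreviation subspace_as_space :: "nat \<Rightarrow> 'a::field vec set \<Rightarrow> ('a, 'a vec) module" where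
  "subspace_as_space n C \<equiv> (module_vec TYPE('a) n)\<lparr>carrier := C\<rparr>"

definition linear_code :: "nat \<Rightarrow> nat \<Rightarrow> nat \<Rightarrow> 'a::{field,finite} vec set \<Rightarrow> bool" where
  "linear_code n k d C \<longleftrightarrow>
     VectorSpace.subspace class_ring C (module_vec TYPE('a) n) \<and>
     vectorspace.dim class_ring (subspace_as_space n C) = k \<and>
     min_distance C = d"

definition generator_matrix :: "nat \<Rightarrow> 'a::field vec set \<Rightarrow> 'a mat \<Rightarrow> bool" where
  "generator_matrix n C G \<longleftrightarrow>
     dim_col G = n \<and> distinct (rows G) \<and>
     vectorspace.basis class_ring (subspace_as_space n C) (set (rows G))"

definition nearest_codeword :: "'a vec set \<Rightarrow> 'a vec \<Rightarrow> 'a vec \<Rightarrow> bool" where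
  "nearest_codeword C y c \<longleftrightarrow> is_arg_min (hamming_dist y) (\<lambda>c. c \<in> C) c"

definition admissible_errors :: "nat \<Rightarrow> nat \<Rightarrow> 'a::{field,finite} vec set" where
  "admissible_errors n t =
     {e \<in> carrier_vec n. (\<forall>i<n. e $ i \<in> {0, 1}) \<and> hamming_weight e \<le> t}"

definition defect_sets :: "nat \<Rightarrow> nat \<Rightarrow> nat set set" where
  "defect_sets n u = {\<phi>. \<phi> \<subseteq> {0..<n} \<and> card \<phi> = u}"

definition PDMC :: "nat \<Rightarrow> nat \<Rightarrow> nat \<Rightarrow> nat \<Rightarrow> 'm set \<Rightarrow>
    (nat set \<Rightarrow> 'm \<Rightarrow> 'a::{field,finite} vec) \<Rightarrow> ('a vec \<Rightarrow> 'm) \<Rightarrow> bool" where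
  "PDMC n M u t Ms E D \<longleftrightarrow>
     finite Ms \<and> card Ms = M \<and>
     (\<forall>\<phi>\<in>defect_sets n u. \<forall>m\<in>Ms.
        E \<phi> m \<in> carrier_vec n \<and>
        (\<forall>e\<in>admissible_errors n t.
           (\<forall>i\<in>\<phi>. (E \<phi> m + e) $ i \<noteq> 0) \<and> D (E \<phi> m + e) = m))"

definition append_cols :: "'a::zero mat \<Rightarrow> 'a mat \<Rightarrow> 'a mat" (infixr \<open>@\<^sub>c\<close> 65) where
  "A @\<^sub>c B = four_block_mat A B (0\<^sub>m 0 (dim_col A)) (0\<^sub>m 0 (dim_col B))"

definition G1 :: "nat \<Rightarrow> nat \<Rightarrow> 'a::field mat \<Rightarrow> 'a mat" where
  "G1 n r P = 0\<^sub>m (n - r - 1) 1 @\<^sub>c 1\<^sub>m (n - r - 1) @\<^sub>c P"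

definition G0 :: "nat \<Rightarrow> 'a::field vec" where
  "G0 n = vec n (\<lambda>_. 1)"

definition scheme_matrix :: "nat \<Rightarrow> nat \<Rightarrow> 'a::field mat \<Rightarrow> 'a mat" where
  "scheme_matrix n r P = G1 n r P @\<^sub>r mat_of_rows n [G0 n]"

text \<open>The row vector \<open>m G\<^sub>1\<close>; the library only has matrix times column vector.\<close>

definition scheme_word :: "nat \<Rightarrow> nat \<Rightarrow> 'a::field mat \<Rightarrow> 'a vec \<Rightarrow> 'a vec" where
  "scheme_word n r P m = (G1 n r P)\<^sup>T *\<^sub>v m"

definition valid_shift ::
    "nat \<Rightarrow> nat \<Rightarrow> 'a::field mat \<Rightarrow> nat set \<Rightarrow> 'a vec \<Rightarrow> 'a \<Rightarrow> bool" where
  "valid_shift n r P \<phi> m v \<longleftrightarrow>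
     (\<forall>i\<in>\<phi>. scheme_word n r P m $ i \<noteq> v \<and> scheme_word n r P m $ i \<noteq> v + 1)"

text \<open>The scheme leaves open which valid \<open>v\<close> is taken, and which nearest codeword in case of a tie;
  hence its encoders and decoders are characterised by predicates.\<close>

definition scheme_encoder :: "nat \<Rightarrow> nat \<Rightarrow> nat \<Rightarrow> 'a::field mat \<Rightarrow>
    (nat set \<Rightarrow> 'a vec \<Rightarrow> 'a vec) \<Rightarrow> bool" where
  "scheme_encoder n r u P E \<longleftrightarrow>
     (\<forall>\<phi>\<in>defect_sets n u. \<forall>m\<in>carrier_vec (n - r - 1).
        \<exists>v. valid_shift n r P \<phi> m v \<and>
            E \<phi> m = scheme_word n r P m + (- (v + 1)) \<cdot>\<^sub>v G0 n)"

definition message_of :: "nat \<Rightarrow> nat \<Rightarrow> 'a::field mat \<Rightarrow> 'a vec \<Rightarrow> 'a vec \<Rightarrow> bool" where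
  "message_of n r P c m \<longleftrightarrow>
     m \<in> carrier_vec (n - r - 1) \<and> (\<exists>z. c = scheme_word n r P m + z \<cdot>\<^sub>v G0 n)"

definition scheme_decoder :: "nat \<Rightarrow> nat \<Rightarrow> 'a::field mat \<Rightarrow> 'a vec set \<Rightarrow>
    ('a vec \<Rightarrow> 'a vec) \<Rightarrow> bool" where
  "scheme_decoder n r P C D \<longleftrightarrow>
     (\<forall>y\<in>carrier_vec n. \<exists>c. nearest_codeword C y c \<and> message_of n r P c (D y))"

end

theory Submission
  imports Defs "Berlekamp_Zassenhaus.Berlekamp_Type_Based"
begin

text \<open>Since \<open>G\<^sub>0\<close> is the all-one vector and the first column of \<open>G\<^sub>1\<close> vanishes, coordinate \<open>0\<close>
  of a codeword \<open>m G\<^sub>1 + z G\<^sub>0\<close> is \<open>z\<close>, and subtracting it from the systematic coordinates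
  recovers \<open>m\<close>. Each of the \<open>u\<close> defects rules out two values of \<open>v\<close>, and \<open>2 u < q\<close>, so a shift
  exists; it keeps the defective cells away from \<open>0\<close> and \<open>-1\<close>, so errors in \<open>{0, 1}\<close> cannot
  produce a \<open>0\<close> there. As \<open>d > 2 t\<close>, nearest-codeword decoding removes the error.\<close>

section \<open>Words of the scheme and recovery of the message\<close>

lemma scheme_word_carrier:
  assumes "n - r - 1 \<ge> 1" and "P \<in> carrier_mat (n - r - 1) r"
  shows "scheme_word n r P m \<in> carrier_vec n"
proof -
  have "dim_col (G1 n r P) = n"
    using assms by (auto simp: G1_def append_cols_def)
  then show ?thesis by (intro carrier_vecI) (simp add: scheme_word_def)
qed

text \<open>Entry \<open>i\<close> is the inner product of column \<open>i\<close> of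
  \<open>G1 n r P\<close> with \<open>m\<close>. The zero column comes first, so the identity block
  starts at column 1, whence the \<open>Suc\<close>.\<close>

lemma scheme_word_systematic:
  assumes "n - r - 1 \<ge> 1" and "P \<in> carrier_mat (n - r - 1) r"
    and "m \<in> carrier_vec (n - r - 1)"
  shows scheme_word_0: "scheme_word n r P m $ 0 = 0"
    and scheme_word_Suc: "j < n - r - 1 \<Longrightarrow> scheme_word n r P m $ Suc j = m $ j"
proof -
  have dims: "dim_row (G1 n r P) = n - r - 1" "dim_col (G1 n r P) = n"
    using assms by (auto simp: G1_def append_cols_def)
  have "col (G1 n r P) 0 = 0\<^sub>v (n - r - 1)"
    using assms(1,2) dims by (intro eq_vecI) (auto simp: G1_def append_cols_def)
  then show "scheme_word n r P m $ 0 = 0"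
    using assms dims by (simp add: scheme_word_def)
  assume j: "j < n - r - 1"
  have "col (G1 n r P) (Suc j) = unit_vec (n - r - 1) j"
    using assms(1,2) j dims by (intro eq_vecI) (auto simp: G1_def append_cols_def)
  then show "scheme_word n r P m $ Suc j = m $ j"
    using assms j dims by (simp add: scheme_word_def)
qed

text \<open>The two hypotheses may a priori hold with different multiples of \<open>G0 n\<close>;
  the formula \<open>m $ j = c $ Suc j - c $ 0\<close> expresses the message through
  \<open>c\<close> alone.\<close>

lemma message_of_unique:
  assumes "n - r - 1 \<ge> 1" and "P \<in> carrier_mat (n - r - 1) r"
    and "message_of n r P c m" and "message_of n r P c m'"
  shows "m = m'"
proof -
  have c: "m $ j = c $ Suc j - c $ 0" if m: "message_of n r P c m" and j: "j < n - r - 1" for m j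
  proof -
    obtain z where z: "c = scheme_word n r P m + z \<cdot>\<^sub>v G0 n" and m: "m \<in> carrier_vec (n - r - 1)"
      using m by (auto simp: message_of_def)
    show ?thesis
      using assms(1,2) j scheme_word_systematic[OF assms(1,2) m] by (simp add: z G0_def)
  qed
  show ?thesis
  proof (rule eq_vecI)
    show "dim_vec m = dim_vec m'"
      using assms(3,4) by (auto simp: message_of_def)
    show "m $ i = m' $ i" if "i < dim_vec m'" for i
      using c[OF assms(3)] c[OF assms(4)] assms(4) that by (auto simp: message_of_def)
  qed
qed

section \<open>The code as the set of all words of the scheme\<close>

lemma scheme_matrix_carrier:
  assumes "n - r - 1 \<ge> 1" and "P \<in> carrier_mat (n - r - 1) r"
  shows "scheme_matrix n r P \<in> carrier_mat (n - r - 1 + 1) n"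
  using assms unfolding scheme_matrix_def
  by (intro carrier_append_rows) (auto simp: G1_def append_cols_def)

text \<open>Column \<open>i\<close> of the stacked matrix is column \<open>i\<close> of
  \<open>G1 n r P\<close> followed by 1, so its inner product splits off the summand
  \<open>z\<close>.\<close>

lemma transpose_scheme_matrix_mult_vec:
  assumes "n - r - 1 \<ge> 1" and "P \<in> carrier_mat (n - r - 1) r"
    and "m \<in> carrier_vec (n - r - 1)"
  shows "(scheme_matrix n r P)\<^sup>T *\<^sub>v (m @\<^sub>v vec 1 (\<lambda>_. z)) = scheme_word n r P m + z \<cdot>\<^sub>v G0 n"
proof (rule eq_vecI)
  have dims: "dim_row (G1 n r P) = n - r - 1" "dim_col (G1 n r P) = n"
    using assms by (auto simp: G1_def append_cols_def)
  note cM = scheme_matrix_carrier[OF assms(1,2)]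
  show "dim_vec ((scheme_matrix n r P)\<^sup>T *\<^sub>v (m @\<^sub>v vec 1 (\<lambda>_. z))) =
      dim_vec (scheme_word n r P m + z \<cdot>\<^sub>v G0 n)"
    using cM by (simp add: G0_def)
  fix i assume "i < dim_vec (scheme_word n r P m + z \<cdot>\<^sub>v G0 n)"
  then have i: "i < n" by (simp add: G0_def)
  have "col (scheme_matrix n r P) i = col (G1 n r P) i @\<^sub>v vec 1 (\<lambda>_. 1)"
    using dims i cM
    by (intro eq_vecI) (auto simp: scheme_matrix_def append_rows_def mat_of_rows_def G0_def)
  moreover have "(col (G1 n r P) i @\<^sub>v vec 1 (\<lambda>_. 1)) \<bullet> (m @\<^sub>v vec 1 (\<lambda>_. z)) =
      col (G1 n r P) i \<bullet> m + vec 1 (\<lambda>_. 1) \<bullet> vec 1 (\<lambda>_. z)"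
    using dims assms(3) by (intro scalar_prod_append carrier_vecI) auto
  ultimately show "((scheme_matrix n r P)\<^sup>T *\<^sub>v (m @\<^sub>v vec 1 (\<lambda>_. z))) $ i =
      (scheme_word n r P m + z \<cdot>\<^sub>v G0 n) $ i"
    using i dims cM by (simp add: scheme_word_def G0_def scalar_prod_def)
qed

text \<open>The rows of \<open>G\<close> span \<open>C\<close>, and the row space of
  \<open>G\<close> is the column space of its transpose.\<close>

lemma generator_matrix_code_eq:
  fixes C :: "'a::field vec set"
  assumes "VectorSpace.subspace class_ring C (module_vec TYPE('a) n)"
    and "generator_matrix n C G"
  shows "C = {G\<^sup>T *\<^sub>v x | x. x \<in> carrier_vec (dim_row G)}"
proof -
  interpret vec_space "TYPE('a)" n .
  have vs: "vectorspace class_ring (subspace_as_space n C)"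
    using assms(1) subspace_is_vs by simp
  have G: "G\<^sup>T \<in> carrier_mat n (dim_row G)"
    using assms(2) by (auto simp: generator_matrix_def)
  have "vectorspace.basis class_ring (subspace_as_space n C) (set (rows G))"
    using assms(2) by (simp add: generator_matrix_def)
  then have sub: "set (rows G) \<subseteq> C"
    and gen: "LinearCombinations.module.span class_ring (subspace_as_space n C) (set (rows G)) = C"
    by (simp_all add: vectorspace.basis_def[OF vs])
  \<comment> \<open>\<open>gen\<close> speaks of the span inside the subspace structure; for a
    subset of \<open>C\<close> it agrees with the span in the ambient space.\<close>
  have "C = span (set (rows G))"
    using assms(1) gen span_li_not_depend(1)[OF sub] by (simp add: VectorSpace.subspace_def)
  also have "\<dots> = col_space G\<^sup>T"
    by (simp add: col_space_def)
  also have "\<dots> = {y \<in> carrier_vec n. \<exists>x\<in>carrier_vec (dim_row G). G\<^sup>T *\<^sub>v x = y}"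
    unfolding col_space_eq[OF G] carrier_matD[OF G] ..
  also have "\<dots> = {G\<^sup>T *\<^sub>v x | x. x \<in> carrier_vec (dim_row G)}"
    using mult_mat_vec_carrier[OF G] by blast
  finally show ?thesis .
qed

text \<open>The last entry of a coefficient vector multiplies the row \<open>G0 n\<close>, so it
  plays the role of \<open>z\<close>, and the entries before it form the message.\<close>

lemma scheme_code_iff_message:
  fixes C :: "'a::field vec set"
  assumes "n - r - 1 \<ge> 1" and "P \<in> carrier_mat (n - r - 1) r"
    and "VectorSpace.subspace class_ring C (module_vec TYPE('a) n)"
    and "generator_matrix n C (scheme_matrix n r P)"
  shows "c \<in> C \<longleftrightarrow> (\<exists>m. message_of n r P c m)"
proof
  note C = generator_matrix_code_eq[OF assms(3,4)]
  have dim: "dim_row (scheme_matrix n r P) = n - r - 1 + 1"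
    using scheme_matrix_carrier[OF assms(1,2)] by simp
  show "\<exists>m. message_of n r P c m" if "c \<in> C"
  proof -
    from that obtain x where x: "x \<in> carrier_vec (n - r - 1 + 1)"
      and c: "c = (scheme_matrix n r P)\<^sup>T *\<^sub>v x"
      unfolding C dim by blast
    define m where "m = vec_first x (n - r - 1)"
    have m: "m \<in> carrier_vec (n - r - 1)" by (simp add: m_def)
    have "x = m @\<^sub>v vec 1 (\<lambda>_. x $ (n - r - 1))"
    proof (rule eq_vecI)
      show "x $ i = (m @\<^sub>v vec 1 (\<lambda>_. x $ (n - r - 1))) $ i"
        if "i < dim_vec (m @\<^sub>v vec 1 (\<lambda>_. x $ (n - r - 1)))" for i
      proof (cases "i < n - r - 1")
        case False
        then have "i = n - r - 1"
          using that by (simp add: m_def)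
        then show ?thesis by (simp add: m_def)
      qed (simp add: m_def vec_first_def)
    qed (use x in \<open>simp add: m_def\<close>)
    then have "c = scheme_word n r P m + x $ (n - r - 1) \<cdot>\<^sub>v G0 n"
      using c transpose_scheme_matrix_mult_vec[OF assms(1,2) m] by metis
    then show ?thesis
      using m unfolding message_of_def by blast
  qed
  show "c \<in> C" if "\<exists>m. message_of n r P c m"
  proof -
    from that obtain m z where m: "m \<in> carrier_vec (n - r - 1)"
      and c: "c = scheme_word n r P m + z \<cdot>\<^sub>v G0 n"
      by (auto simp: message_of_def)
    have "m @\<^sub>v vec 1 (\<lambda>_. z) \<in> carrier_vec (n - r - 1 + 1)"
      using m by (intro append_carrier_vec) auto
    then show ?thesis
      unfolding C dim c transpose_scheme_matrix_mult_vec[OF assms(1,2) m, symmetric] by blast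
  qed
qed

section \<open>Hamming distance and nearest-codeword decoding\<close>

lemma hamming_dist_commute:
  assumes "dim_vec x = dim_vec y"
  shows "hamming_dist x y = hamming_dist y x"
  using assms by (simp add: hamming_dist_def eq_commute)

text \<open>Where \<open>x\<close> and \<open>z\<close> differ, \<open>y\<close> differs from one of
  them. The index range of \<open>hamming_dist\<close> is read off its first argument, so
  \<open>x\<close> and \<open>y\<close> must have equal length.\<close>

lemma hamming_dist_triangle:
  assumes "dim_vec x = dim_vec y"
  shows "hamming_dist x z \<le> hamming_dist x y + hamming_dist y z"
proof -
  have "hamming_dist x z \<le>
      card ({i. i < dim_vec x \<and> x $ i \<noteq> y $ i} \<union> {i. i < dim_vec y \<and> y $ i \<noteq> z $ i})"
    unfolding hamming_dist_def using assms by (intro card_mono) auto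
  also have "\<dots> \<le> hamming_dist x y + hamming_dist y z"
    unfolding hamming_dist_def by (rule card_Un_le)
  finally show ?thesis .
qed

lemma hamming_dist_add_error:
  fixes c e :: "'a::ab_group_add vec"
  assumes "dim_vec c = dim_vec e"
  shows "hamming_dist c (c + e) = hamming_weight e"
  using assms unfolding hamming_dist_def hamming_weight_def
  by (auto intro!: arg_cong[of _ _ card])

text \<open>Finiteness of \<open>C\<close> makes the set of distances finite, so that its
  \<open>Min\<close> is a lower bound.\<close>

lemma min_distance_le:
  assumes "finite C" "x \<in> C" "y \<in> C" "x \<noteq> y"
  shows "min_distance C \<le> hamming_dist x y"
proof -
  have "{hamming_dist x y | x y. x \<in> C \<and> y \<in> C \<and> x \<noteq> y} \<subseteq> (\<lambda>(x, y). hamming_dist x y) ` (C \<times> C)"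
    by auto
  then have "finite {hamming_dist x y | x y. x \<in> C \<and> y \<in> C \<and> x \<noteq> y}"
    by (rule finite_subset) (simp add: assms(1))
  then show ?thesis
    unfolding min_distance_def using assms by (intro Min_le) auto
qed

lemma nearest_codeword_exists:
  assumes "finite C" "C \<noteq> {}"
  shows "\<exists>c. nearest_codeword C y c"
  unfolding nearest_codeword_def is_arg_min_def using ex_min_if_finite[of "hamming_dist y ` C"] assms
  by fastforce

text \<open>The sent word \<open>c\<close> competes for being nearest, so \<open>c'\<close> is at
  most as far from \<open>c + e\<close> as \<open>c\<close> is. Hence \<open>c\<close> and
  \<open>c'\<close> are at distance at most \<open>2 * t\<close>, too close for distinct
  codewords.\<close>

lemma nearest_codeword_add_error:
  fixes C :: "'a::{ab_group_add,finite} vec set"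
  assumes "C \<subseteq> carrier_vec n" and "2 * t < min_distance C"
    and "c \<in> C" and "e \<in> carrier_vec n" and "hamming_weight e \<le> t"
    and "nearest_codeword C (c + e) c'"
  shows "c' = c"
proof (rule ccontr)
  assume "c' \<noteq> c"
  have c': "c' \<in> C" "hamming_dist (c + e) c' \<le> hamming_dist (c + e) c"
    using assms(3,6) by (auto simp: nearest_codeword_def is_arg_min_linorder)
  have dims: "dim_vec c = n" "dim_vec e = n" "dim_vec c' = n"
    using assms c' by auto
  have "min_distance C \<le> hamming_dist c c'"
    using assms(1,3) c' \<open>c' \<noteq> c\<close> by (intro min_distance_le) (auto intro: finite_subset)
  also have "\<dots> \<le> hamming_dist c (c + e) + hamming_dist (c + e) c'"
    using dims by (intro hamming_dist_triangle) simp
  also have "\<dots> \<le> 2 * hamming_weight e"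
    using c' dims by (simp add: hamming_dist_commute[of "c + e" c] hamming_dist_add_error)
  finally show False
    using assms(2,5) by linarith
qed

section \<open>Choice of the shift and its effect on defective cells\<close>

lemma valid_shift_exists:
  fixes P :: "'a::{field,finite} mat"
  assumes "u \<le> (CARD('a) - 1) div 2" and "\<phi> \<in> defect_sets n u"
  shows "\<exists>v. valid_shift n r P \<phi> m v"
proof -
  define w where "w = scheme_word n r P m"
  have \<phi>: "finite \<phi>" "card \<phi> = u"
    using assms(2) by (auto simp: defect_sets_def intro: finite_subset)
  \<comment> \<open>The union collects all forbidden shifts: position \<open>i\<close> excludes
    exactly \<open>w $ i\<close> and \<open>w $ i - 1\<close>.\<close>
  have "card ((\<lambda>i. w $ i) ` \<phi> \<union> (\<lambda>i. w $ i - 1) ` \<phi>) \<le> u + u"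
    using card_image_le[OF \<phi>(1), of "\<lambda>i. w $ i"] card_image_le[OF \<phi>(1), of "\<lambda>i. w $ i - 1"]
    by (intro order_trans[OF card_Un_le] add_mono) (simp_all add: \<phi>(2))
  also have "\<dots> < CARD('a)"
  proof -
    \<comment> \<open>Positivity turns \<open>2 * u \<le> CARD('a) - 1\<close>, with truncated
      subtraction, into a strict bound.\<close>
    have "0 < CARD('a)" by simp
    then show ?thesis using assms(1) by linarith
  qed
  finally have "(\<lambda>i. w $ i) ` \<phi> \<union> (\<lambda>i. w $ i - 1) ` \<phi> \<noteq> UNIV"
    by auto
  then obtain v where v: "v \<notin> (\<lambda>i. w $ i) ` \<phi> \<union> (\<lambda>i. w $ i - 1) ` \<phi>"
    by blast
  have "w $ i \<noteq> v \<and> w $ i \<noteq> v + 1" if "i \<in> \<phi>" for i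
  proof -
    have "v \<noteq> w $ i" "v \<noteq> w $ i - 1"
      using v that by blast+
    then show ?thesis by (metis add_diff_cancel_right')
  qed
  then show ?thesis
    by (auto simp: valid_shift_def w_def)
qed

text \<open>Subtracting \<open>v + 1\<close> moves the two values avoided by the word,
  \<open>v + 1\<close> and \<open>v\<close>, to 0 and -1.\<close>

lemma scheme_encoder_avoids:
  fixes P :: "'a::field mat"
  assumes "n - r - 1 \<ge> 1" and "P \<in> carrier_mat (n - r - 1) r"
    and "scheme_encoder n r u P E" and "\<phi> \<in> defect_sets n u" and "m \<in> carrier_vec (n - r - 1)"
    and "i \<in> \<phi>"
  shows "E \<phi> m $ i \<in> UNIV - {0, - 1}"
proof -
  obtain v where v: "valid_shift n r P \<phi> m v"
    and E: "E \<phi> m = scheme_word n r P m + (- (v + 1)) \<cdot>\<^sub>v G0 n"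
    using assms(3-5) by (auto simp: scheme_encoder_def)
  have i: "i < n"
    using assms(4,6) by (auto simp: defect_sets_def)
  have "E \<phi> m $ i = scheme_word n r P m $ i - (v + 1)"
    using i by (simp add: E G0_def)
  moreover have "scheme_word n r P m $ i \<noteq> v" "scheme_word n r P m $ i \<noteq> v + 1"
    using v assms(6) by (simp_all add: valid_shift_def)
  moreover have "w - (v + 1) = - 1 \<longleftrightarrow> w = v" for w :: 'a
    by (simp add: diff_eq_eq)
  ultimately show ?thesis
    by simp
qed

text \<open>The multiple \<open>- (v + 1)\<close> added by the encoder serves as the witness
  \<open>z\<close>.\<close>

lemma scheme_encoder_message:
  assumes "scheme_encoder n r u P E" and "\<phi> \<in> defect_sets n u" and "m \<in> carrier_vec (n - r - 1)"
  shows "message_of n r P (E \<phi> m) m"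
  using assms unfolding scheme_encoder_def message_of_def by blast

text \<open>The first three conjuncts ensure that encoders and decoders of the scheme exist, so that
  the universally quantified claims about \<open>E\<close> and \<open>D\<close> are not
  vacuous.\<close>

theorem theorem1:
  fixes q n k d r t u :: nat
    and C :: "'a::{field,finite} vec set"
    and P :: "'a mat"
  assumes "q = CARD('a)"
    and "n \<ge> 1"
    and "n - r - 1 \<ge> 1"
    and "u \<le> min n ((q - 1) div 2)"
    and "linear_code n k d C"
    and "k = n - r"
    and "d \<ge> 2 * t + 1"
    and "P \<in> carrier_mat (n - r - 1) r"
    and "generator_matrix n C (scheme_matrix n r P)"
  shows "(\<forall>\<phi>\<in>defect_sets n u. \<forall>m\<in>carrier_vec (n - r - 1). \<exists>v. valid_shift n r P \<phi> m v)
    \<and> (\<forall>y\<in>carrier_vec n. \<exists>c. nearest_codeword C y c)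
    \<and> (\<forall>c\<in>C. \<exists>!m. message_of n r P c m)
    \<and> (\<forall>E. scheme_encoder n r u P E \<longrightarrow>
         (\<forall>\<phi>\<in>defect_sets n u. \<forall>m\<in>carrier_vec (n - r - 1). \<forall>i\<in>\<phi>. E \<phi> m $ i \<in> UNIV - {0, - 1}))
    \<and> (\<forall>E D. scheme_encoder n r u P E \<and> scheme_decoder n r P C D \<longrightarrow>
         PDMC n (q ^ (n - r - 1)) u t (carrier_vec (n - r - 1)) E D)"
proof (intro conjI)
  have C: "VectorSpace.subspace class_ring C (module_vec TYPE('a) n)" and d: "min_distance C = d"
    using assms(5) by (auto simp: linear_code_def)
  note iff = scheme_code_iff_message[OF assms(3,8) C assms(9)]
  have word: "scheme_word n r P m \<in> carrier_vec n" for m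
    using scheme_word_carrier[OF assms(3,8)] .
  have sub: "C \<subseteq> carrier_vec n"
    unfolding iff subset_iff message_of_def using word by (auto simp: G0_def)
  then have fin: "finite C"
    by (rule finite_subset) simp
  \<comment> \<open>The zero message supplies a codeword, as the existence of a nearest codeword
    requires.\<close>
  have "message_of n r P (scheme_word n r P (0\<^sub>v (n - r - 1)) + 0 \<cdot>\<^sub>v G0 n) (0\<^sub>v (n - r - 1))"
    unfolding message_of_def by auto
  then have ne: "C \<noteq> {}"
    using iff by blast
  show "\<forall>\<phi>\<in>defect_sets n u. \<forall>m\<in>carrier_vec (n - r - 1). \<exists>v. valid_shift n r P \<phi> m v"
    using assms(1,4) by (intro ballI valid_shift_exists) simp_all
  show "\<forall>y\<in>carrier_vec n. \<exists>c. nearest_codeword C y c"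
    using nearest_codeword_exists[OF fin ne] by blast
  show "\<forall>c\<in>C. \<exists>!m. message_of n r P c m"
    using iff message_of_unique[OF assms(3,8)] by blast
  show "\<forall>E. scheme_encoder n r u P E \<longrightarrow>
      (\<forall>\<phi>\<in>defect_sets n u. \<forall>m\<in>carrier_vec (n - r - 1). \<forall>i\<in>\<phi>. E \<phi> m $ i \<in> UNIV - {0, - 1})"
    using scheme_encoder_avoids[OF assms(3,8)] by blast
  show "\<forall>E D. scheme_encoder n r u P E \<and> scheme_decoder n r P C D \<longrightarrow>
      PDMC n (q ^ (n - r - 1)) u t (carrier_vec (n - r - 1)) E D"
  proof (intro allI impI)
    fix E :: "nat set \<Rightarrow> 'a vec \<Rightarrow> 'a vec" and D
    assume "scheme_encoder n r u P E \<and> scheme_decoder n r P C D"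
    then have E: "scheme_encoder n r u P E" and D: "scheme_decoder n r P C D"
      by auto
    have "E \<phi> m \<in> carrier_vec n \<and>
        (\<forall>e\<in>admissible_errors n t. (\<forall>i\<in>\<phi>. (E \<phi> m + e) $ i \<noteq> 0) \<and> D (E \<phi> m + e) = m)"
      if \<phi>: "\<phi> \<in> defect_sets n u" and m: "m \<in> carrier_vec (n - r - 1)" for \<phi> m
    proof (intro conjI ballI)
      have msg: "message_of n r P (E \<phi> m) m"
        using scheme_encoder_message[OF E \<phi> m] .
      then have cC: "E \<phi> m \<in> C"
        using iff by blast
      then show c: "E \<phi> m \<in> carrier_vec n"
        using sub by blast
      fix e :: "'a vec" assume "e \<in> admissible_errors n t"
      then have e: "e \<in> carrier_vec n" "\<And>i. i < n \<Longrightarrow> e $ i \<in> {0, 1}" "hamming_weight e \<le> t"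
        by (auto simp: admissible_errors_def)
      show "(E \<phi> m + e) $ i \<noteq> 0" if "i \<in> \<phi>" for i
      proof -
        have i: "i < n"
          using \<phi> that by (auto simp: defect_sets_def)
        have "E \<phi> m $ i \<noteq> 0" "E \<phi> m $ i \<noteq> - 1"
          using scheme_encoder_avoids[OF assms(3,8) E \<phi> m that] by auto
        \<comment> \<open>An error entry 0 keeps a nonzero value, and an error entry 1 yields 0 only
          from -1.\<close>
        then show ?thesis
          using e(1) e(2)[OF i] c i by (auto simp: add_eq_0_iff2)
      qed
      obtain c' where c': "nearest_codeword C (E \<phi> m + e) c'"
        and msg': "message_of n r P c' (D (E \<phi> m + e))"
        using D c e(1) unfolding scheme_decoder_def by (meson add_carrier_vec)
      \<comment> \<open>Decoding returns the sent word, so \<open>m\<close> and the decoder output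
        are messages of one and the same codeword.\<close>
      have "c' = E \<phi> m"
        using nearest_codeword_add_error[OF sub _ cC e(1,3) c'] d assms(7) by simp
      then show "D (E \<phi> m + e) = m"
        using message_of_unique[OF assms(3,8)] msg msg' by blast
    qed
    then show "PDMC n (q ^ (n - r - 1)) u t (carrier_vec (n - r - 1)) E D"
      unfolding PDMC_def using assms(1) by (simp add: card_carrier_vec)
  qed
qed

end
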